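(* Consider an increasing sequence $\{a_n\}$ of positive integers together with a notion of legal decomposition such that every positive integer has a unique legal decomposition, and suppose: (1) the rule for legal decompositions acts over a fixed distance; (2) the average number of summands in the legal decompositions of $m\in[a_n,a_{n+1})$ is $\mu_n=Cn+d+o(1)$; (3) given any constant $A>0$ there is a length $L$ and a probability $p=p(A,L)>0$ which is less than or equal to the proportion of legal ways to choose summands in any segment of length $L$ that have at least $A$ summands, regardless of the choices of summands outside the segment. Then $C>0$.
   Context: Given a length $L$, a segment of summands of a legal decomposition starting at index $i$ consists of the summands taken from $\{a_i,a_{i+1},\dots,a_{i+L-1}\}$ (counted with multiplicity if the rule allows repeated summands). The legal decomposition rule acts over a fixed distance if there is a finite number $f$ such that any two segments of a decomposition separated by at least $f$ consecutive unchosen terms do not interact: the choices in one segment do not affect the choices in the other, and the whole decomposition is legal exactly when each of these segments is legal. *)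

theory Defs
  imports Complex_Main
begin

text \<open>A decomposition is a finitely supported coefficient function c, where c i is the
number of times the summand a i is used (multiplicity allowed).\<close>

definition fin_supp :: "(nat \<Rightarrow> nat) \<Rightarrow> bool" where
  "fin_supp c \<longleftrightarrow> finite {i. c i \<noteq> 0}"

definition dec_value :: "(nat \<Rightarrow> nat) \<Rightarrow> (nat \<Rightarrow> nat) \<Rightarrow> nat" where
  "dec_value a c = (\<Sum>i\<in>{i. c i \<noteq> 0}. c i * a i)"

definition num_summands :: "(nat \<Rightarrow> nat) \<Rightarrow> nat" where
  "num_summands c = (\<Sum>i\<in>{i. c i \<noteq> 0}. c i)"

definition legal_dec_of :: "((nat \<Rightarrow> nat) \<Rightarrow> bool) \<Rightarrow> (nat \<Rightarrow> nat) \<Rightarrow> nat \<Rightarrow> (nat \<Rightarrow> nat) \<Rightarrow> bool" where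
  "legal_dec_of legal a m c \<longleftrightarrow> legal c \<and> fin_supp c \<and> dec_value a c = m"

definition unique_legal_decomp :: "((nat \<Rightarrow> nat) \<Rightarrow> bool) \<Rightarrow> (nat \<Rightarrow> nat) \<Rightarrow> bool" where
  "unique_legal_decomp legal a \<longleftrightarrow> (\<forall>m>0. \<exists>!c. legal_dec_of legal a m c)"

definition the_dec :: "((nat \<Rightarrow> nat) \<Rightarrow> bool) \<Rightarrow> (nat \<Rightarrow> nat) \<Rightarrow> nat \<Rightarrow> (nat \<Rightarrow> nat)" where
  "the_dec legal a m = (THE c. legal_dec_of legal a m c)"

definition avg_summands :: "((nat \<Rightarrow> nat) \<Rightarrow> bool) \<Rightarrow> (nat \<Rightarrow> nat) \<Rightarrow> nat \<Rightarrow> real" where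
  "avg_summands legal a n =
     (\<Sum>m\<in>{a n..<a (Suc n)}. real (num_summands (the_dec legal a m))) / real (a (Suc n) - a n)"

definition acts_over_fixed_distance :: "((nat \<Rightarrow> nat) \<Rightarrow> bool) \<Rightarrow> nat \<Rightarrow> bool" where
  "acts_over_fixed_distance legal f \<longleftrightarrow>
     (\<forall>c s. fin_supp c \<longrightarrow> (\<forall>i\<in>{s..<s+f}. c i = 0) \<longrightarrow>
        (legal c \<longleftrightarrow> legal (\<lambda>i. if i < s then c i else 0) \<and> legal (\<lambda>i. if s + f \<le> i then c i else 0)))"

definition segment_fillings :: "((nat \<Rightarrow> nat) \<Rightarrow> bool) \<Rightarrow> nat \<Rightarrow> nat \<Rightarrow> (nat \<Rightarrow> nat) \<Rightarrow> (nat \<Rightarrow> nat) set" where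
  "segment_fillings legal i L c =
     {s. (\<forall>j. j \<notin> {i..<i+L} \<longrightarrow> s j = 0) \<and> legal (\<lambda>j. c j + s j)}"

definition segment_condition :: "((nat \<Rightarrow> nat) \<Rightarrow> bool) \<Rightarrow> bool" where
  "segment_condition legal \<longleftrightarrow>
     (\<forall>A::real>0. \<exists>L::nat. \<exists>p::real. L > 0 \<and> p > 0 \<and>
        (\<forall>i c. fin_supp c \<longrightarrow> (\<forall>j\<in>{i..<i+L}. c j = 0) \<longrightarrow>
           segment_fillings legal i L c \<noteq> {} \<longrightarrow>
           finite (segment_fillings legal i L c) \<and>
           p * real (card (segment_fillings legal i L c))
             \<le> real (card {s\<in>segment_fillings legal i L c. real (num_summands s) \<ge> A})))"

end

theory Submission
  imports Defs
begin

text \<open>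
  If \<open>C \<le> 0\<close>, the averages are bounded, so the mean number of summands over \<open>[a\<^sub>0, a\<^sub>N)\<close> is at
  most some \<open>K\<close>, uniformly in \<open>N\<close>. Cut the indices into blocks of length \<open>L + 2 f\<close>, where \<open>L\<close>
  belongs to \<open>A = 1\<close>. In the middle of each block there is a nonzero legal filling \<open>s\<close>, and it may
  be added to every legal decomposition vanishing on that block; this shifts the represented number
  by the constant value of \<open>s\<close>. Hence, up to a bounded number of exceptions, at least half of
  the numbers below \<open>a\<^sub>N\<close> use a given block, and with \<open>k > 2 K\<close> blocks the mean number of summands
  exceeds \<open>K\<close> for large \<open>N\<close>.
\<close>

lemma dec_value_superset:
  assumes "finite S" and "{i. c i \<noteq> 0} \<subseteq> S"
  shows "dec_value a c = (\<Sum>i\<in>S. c i * a i)"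
  unfolding dec_value_def using assms by (intro sum.mono_neutral_left) auto

lemma fin_supp_add:
  assumes "fin_supp c" and "fin_supp s"
  shows "fin_supp (\<lambda>i. c i + s i)"
  using assms finite_UnI[of "{i. c i \<noteq> 0}" "{i. s i \<noteq> 0}"]
  by (simp add: fin_supp_def Un_def)

lemma dec_value_add:
  assumes "fin_supp c" and "fin_supp s"
  shows "dec_value a (\<lambda>i. c i + s i) = dec_value a c + dec_value a s"
proof -
  let ?S = "{i. c i \<noteq> 0} \<union> {i. s i \<noteq> 0}"
  have S: "finite ?S"
    using assms by (simp add: fin_supp_def)
  have "dec_value a (\<lambda>i. c i + s i) = (\<Sum>i\<in>?S. (c i + s i) * a i)"
    by (rule dec_value_superset[OF S]) auto
  moreover have "dec_value a c = (\<Sum>i\<in>?S. c i * a i)"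
    by (rule dec_value_superset[OF S]) auto
  moreover have "dec_value a s = (\<Sum>i\<in>?S. s i * a i)"
    by (rule dec_value_superset[OF S]) auto
  ultimately show ?thesis
    by (simp add: sum.distrib distrib_right)
qed

lemma legal_the_dec:
  assumes "unique_legal_decomp legal a" and "m > 0"
  shows "legal_dec_of legal a m (the_dec legal a m)"
  unfolding the_dec_def
  using assms by (simp add: unique_legal_decomp_def theI')

lemma the_dec_eqI:
  assumes "unique_legal_decomp legal a" and "m > 0" and "legal_dec_of legal a m c"
  shows "the_dec legal a m = c"
  using assms legal_the_dec[of legal a m] unfolding unique_legal_decomp_def by blast

text \<open>Cut \<open>c\<close> above its support: the upper part is the zero function, and it
  inherits legality from \<open>c\<close>.\<close>

lemma legal_zero:
  assumes "acts_over_fixed_distance legal f" and "legal c" and "fin_supp c"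
  shows "legal (\<lambda>_. 0)"
proof -
  obtain s where s: "\<And>i. c i \<noteq> 0 \<Longrightarrow> i < s"
    using \<open>fin_supp c\<close> unfolding fin_supp_def finite_nat_set_iff_bounded by blast
  have upper: "(\<lambda>i. if s + f \<le> i then c i else 0) = (\<lambda>_. 0)"
    using s by (fastforce simp: fun_eq_iff)
  have gap: "\<forall>i\<in>{s..<s+f}. c i = 0"
    using s by fastforce
  have "legal (\<lambda>i. if s + f \<le> i then c i else 0)"
    using assms(1)[unfolded acts_over_fixed_distance_def, rule_format, OF assms(3), of s] gap assms(2)
    by blast
  then show ?thesis
    by (simp only: upper)
qed

text \<open>\<open>s\<close> sits in the gap with a zero margin of length \<open>f\<close> on each
  side. Cutting the sum at both margins leaves \<open>c\<close> below the gap, \<open>s\<close>, and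
  \<open>c\<close> above it, each of which is legal.\<close>

lemma legal_add_in_gap:
  assumes f: "acts_over_fixed_distance legal f"
    and c: "fin_supp c" "legal c" "\<And>j. j \<in> {i..<i + (L + 2 * f)} \<Longrightarrow> c j = 0"
    and s: "fin_supp s" "legal s" "\<And>j. j \<notin> {i + f..<i + f + L} \<Longrightarrow> s j = 0"
  shows "legal (\<lambda>j. c j + s j)"
proof -
  let ?u = "\<lambda>j. if i + f \<le> j then c j + s j else 0"
  have split: "legal e \<longleftrightarrow>
      legal (\<lambda>j. if j < r then e j else 0) \<and> legal (\<lambda>j. if r + f \<le> j then e j else 0)"
    if "fin_supp e" "\<And>j. j \<in> {r..<r + f} \<Longrightarrow> e j = 0" for e r
    using f that unfolding acts_over_fixed_distance_def by blast
  have cs: "fin_supp (\<lambda>j. c j + s j)"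
    using c s by (simp add: fin_supp_add)
  then have u: "fin_supp ?u"
    unfolding fin_supp_def by (rule rev_finite_subset) auto
  \<comment> \<open>As \<open>c\<close> vanishes on the whole gap, its part from
    \<open>i + f\<close> on is also what the second cut leaves of \<open>?u\<close> on the
    right.\<close>
  have c_upper: "(\<lambda>j. if i + f \<le> j then c j else 0) =
      (\<lambda>j. if (i + f + L) + f \<le> j then ?u j else 0)"
    using c(3) s(3) by (auto simp: fun_eq_iff)
  have c_parts: "legal (\<lambda>j. if j < i then c j else 0)" "legal (\<lambda>j. if i + f \<le> j then c j else 0)"
    using split[of c i] c by auto
  have "(\<lambda>j. if j < i + f + L then ?u j else 0) = s"
    using c(3) s(3) by (auto simp: fun_eq_iff)
  then have "legal ?u"
    using split[of ?u "i + f + L"] u c(3) s c_parts(2) c_upper by simp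
  moreover have "(\<lambda>j. if j < i then c j else 0) = (\<lambda>j. if j < i then c j + s j else 0)"
    using s(3) by (auto simp: fun_eq_iff)
  ultimately show ?thesis
    using split[OF cs, of i] c(3) s(3) c_parts(1) by simp
qed

text \<open>Take \<open>A = 1\<close> and empty surroundings. The zero filling shows that fillings
  exist, so a positive proportion of them has a summand. The same \<open>L\<close> serves every
  position \<open>i\<close>.\<close>

lemma ex_nonzero_legal_filling:
  assumes "segment_condition legal" and "legal (\<lambda>_. 0)"
  obtains L where "L > 0"
    and "\<And>i. \<exists>s. legal s \<and> s \<noteq> (\<lambda>_. 0) \<and> (\<forall>j. j \<notin> {i..<i+L} \<longrightarrow> s j = 0)"
proof -
  obtain L p where Lp: "L > 0" "p > (0::real)" and
    *: "\<And>i c. \<lbrakk>fin_supp c; \<forall>j\<in>{i..<i+L}. c j = 0; segment_fillings legal i L c \<noteq> {}\<rbrakk> \<Longrightarrow>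
           finite (segment_fillings legal i L c) \<and>
           p * real (card (segment_fillings legal i L c))
             \<le> real (card {s\<in>segment_fillings legal i L c. real (num_summands s) \<ge> 1})"
    using assms(1) unfolding segment_condition_def by (meson zero_less_one)
  have "\<exists>s. legal s \<and> s \<noteq> (\<lambda>_. 0) \<and> (\<forall>j. j \<notin> {i..<i+L} \<longrightarrow> s j = 0)" for i
  proof -
    let ?F = "segment_fillings legal i L (\<lambda>_. 0)"
    have "(\<lambda>_. 0) \<in> ?F"
      using assms(2) by (simp add: segment_fillings_def)
    then have "?F \<noteq> {}"
      by blast
    moreover from this have "finite ?F"
      and "p * real (card ?F) \<le> real (card {s\<in>?F. real (num_summands s) \<ge> 1})"
      using *[of "\<lambda>_. 0" i] by (simp_all add: fin_supp_def)
    moreover from calculation have "0 < p * real (card ?F)"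
      using Lp(2) by (simp add: card_gt_0_iff)
    ultimately have "0 < real (card {s\<in>?F. real (num_summands s) \<ge> 1})"
      by linarith
    then have "{s\<in>?F. real (num_summands s) \<ge> 1} \<noteq> {}"
      by (simp only: of_nat_0_less_iff card_gt_0_iff not_False_eq_True)
    then obtain s where "s \<in> ?F" "num_summands s \<ge> 1"
      by auto
    then show ?thesis
      by (intro exI[of _ s]) (auto simp: segment_fillings_def num_summands_def)
  qed
  with Lp(1) that show thesis
    by blast
qed

text \<open>Each used block contains a support index \<open>i\<close>, and \<open>i div w\<close>
  recovers the block, so there are at most as many used blocks as support indices.\<close>

lemma card_used_blocks_le_num_summands:
  assumes "fin_supp c" and "w > 0"
  shows "card {j \<in> J. \<exists>i\<in>{j*w..<j*w+w}. c i \<noteq> 0} \<le> num_summands c"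
proof -
  let ?S = "{i. c i \<noteq> 0}"
  have S: "finite ?S"
    using assms(1) by (simp add: fin_supp_def)
  have "j \<in> (\<lambda>i. i div w) ` ?S" if "i \<in> {j*w..<j*w+w}" "c i \<noteq> 0" for i j
  proof -
    have "i div w = j"
      using that by (intro div_nat_eqI) (auto simp: mult.commute)
    then show ?thesis
      using that by blast
  qed
  then have "{j \<in> J. \<exists>i\<in>{j*w..<j*w+w}. c i \<noteq> 0} \<subseteq> (\<lambda>i. i div w) ` ?S"
    by blast
  then have "card {j \<in> J. \<exists>i\<in>{j*w..<j*w+w}. c i \<noteq> 0} \<le> card ?S"
    using S surj_card_le by blast
  also have "\<dots> \<le> num_summands c"
    using sum_mono[of ?S "\<lambda>_. 1" c] by (simp add: num_summands_def)
  finally show ?thesis .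
qed

text \<open>Multiplying each mean by the length of its interval gives bounds that add up over
  consecutive intervals.\<close>

lemma sum_summands_le:
  assumes "strict_mono a" and "\<And>n. avg_summands legal a n \<le> K"
  shows "(\<Sum>m\<in>{a 0..<a N}. real (num_summands (the_dec legal a m))) \<le> K * real (a N - a 0)"
proof (induction N)
  case (Suc N)
  have le: "a 0 \<le> a N" "a N < a (Suc N)"
    using assms(1) by (simp_all add: strict_mono_less_eq strict_mono_less)
  have "(\<Sum>m\<in>{a N..<a (Suc N)}. real (num_summands (the_dec legal a m)))
      \<le> K * real (a (Suc N) - a N)"
    using assms(2)[of N] le(2) by (simp add: avg_summands_def divide_le_eq)
  then have "(\<Sum>m\<in>{a 0..<a (Suc N)}. real (num_summands (the_dec legal a m)))
      \<le> K * real (a N - a 0) + K * real (a (Suc N) - a N)"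
    using Suc sum.atLeastLessThan_concat[OF le(1) less_imp_le[OF le(2)],
        of "\<lambda>m. real (num_summands (the_dec legal a m))"] by linarith
  also have "\<dots> = K * real (a (Suc N) - a 0)"
    using le by (simp add: of_nat_diff algebra_simps)
  finally show ?case .
qed simp

text \<open>
  The shift by \<open>v\<close> maps the numbers violating \<open>P\<close> injectively to numbers satisfying \<open>P\<close>, and at
  most \<open>v\<close> of them leave the interval.
\<close>

lemma card_interval_le_twice:
  fixes x y v :: nat
  assumes "\<And>m. x \<le> m \<Longrightarrow> \<not> P m \<Longrightarrow> P (m + v)"
  shows "y - x \<le> 2 * card {m\<in>{x..<y}. P m} + v"
proof -
  have "(\<lambda>m. m + v) ` {m\<in>{x..<y}. \<not> P m} \<subseteq> {m\<in>{x..<y}. P m} \<union> {y..<y+v}"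
    using assms by auto
  from card_mono[OF _ this] have "card {m\<in>{x..<y}. \<not> P m} \<le> card ({m\<in>{x..<y}. P m} \<union> {y..<y+v})"
    by (simp add: card_image)
  also have "\<dots> \<le> card {m\<in>{x..<y}. P m} + v"
    using card_Un_le[of "{m\<in>{x..<y}. P m}" "{y..<y+v}"] by simp
  finally have "card {m\<in>{x..<y}. \<not> P m} \<le> card {m\<in>{x..<y}. P m} + v" .
  moreover have "card {x..<y} = card {m\<in>{x..<y}. P m} + card {m\<in>{x..<y}. \<not> P m}"
    by (subst card_Un_disjoint[symmetric]) (auto intro!: arg_cong[where f = card] simp del: card_atLeastLessThan)
  ultimately show ?thesis
    by simp
qed

theorem theorem2p2:
  fixes a :: "nat \<Rightarrow> nat" and legal :: "(nat \<Rightarrow> nat) \<Rightarrow> bool" and C d :: real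
  assumes pos: "\<And>n. a n > 0"
    and incr: "strict_mono a"
    and uniq: "unique_legal_decomp legal a"
    and fixed: "\<exists>f::nat. acts_over_fixed_distance legal f"
    and mean: "(\<lambda>n. avg_summands legal a n - (C * real n + d)) \<longlonglongrightarrow> 0"
    and seg: "segment_condition legal"
  shows "C > 0"
proof (rule ccontr)
  assume "\<not> C > 0"
  \<comment> \<open>A convergent error term is bounded, and \<open>C * real n\<close> is at most 0,
    so \<open>B + d\<close> bounds all averages.\<close>
  obtain B where "\<And>n. norm (avg_summands legal a n - (C * real n + d)) \<le> B"
    using convergent_imp_Bseq[OF convergentI[OF mean]] by (auto simp: Bseq_def)
  then have "avg_summands legal a n \<le> B + d" for n
    using \<open>\<not> C > 0\<close> mult_nonpos_nonneg[of C "real n"] by (smt (verit) of_nat_0_le_iff real_norm_def)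
  note le_K = sum_summands_le[OF incr this]

  obtain f where f: "acts_over_fixed_distance legal f"
    using fixed by blast
  let ?D = "the_dec legal a"
  have D: "legal (?D m)" "fin_supp (?D m)" "dec_value a (?D m) = m" if "m > 0" for m
    using legal_the_dec[OF uniq that] by (simp_all add: legal_dec_of_def)
  \<comment> \<open>The decomposition of 1 supplies the legal function from which
    \<open>legal_zero\<close> starts.\<close>
  obtain L where "L > 0" and
    L: "\<And>i. \<exists>s. legal s \<and> s \<noteq> (\<lambda>_. 0) \<and> (\<forall>j. j \<notin> {i..<i+L} \<longrightarrow> s j = 0)"
    using ex_nonzero_legal_filling[OF seg legal_zero[OF f D(1,2)[of 1]]] by auto
  define w where "w = L + 2 * f"
  have "w > 0"
    using \<open>L > 0\<close> by (simp add: w_def)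
  define used where "used j m \<longleftrightarrow> (\<exists>i\<in>{j*w..<j*w+w}. ?D m i \<noteq> 0)" for j m
  \<comment> \<open>The shift may depend on the block \<open>j\<close> but not on \<open>m\<close>,
    so that it is injective on the numbers not using the block.\<close>
  have "\<forall>j. \<exists>v. \<forall>m>0. \<not> used j m \<longrightarrow> used j (m + v)"
  proof
    fix j
    obtain s where s: "legal s" "s \<noteq> (\<lambda>_. 0)"
      and "\<forall>i. i \<notin> {j*w + f..<j*w + f + L} \<longrightarrow> s i = 0"
      using L[of "j*w + f"] by (elim exE conjE)
    then have s_supp: "s i = 0" if "i \<notin> {j*w + f..<j*w + f + L}" for i
      using that by blast
    have s_fin: "fin_supp s"
      unfolding fin_supp_def
      by (rule finite_subset[of _ "{j*w + f..<j*w + f + L}"]) (use s_supp in force)+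
    obtain i where i: "s i \<noteq> 0"
      using s(2) by blast
    have "used j (m + dec_value a s)" if "m > 0" "\<not> used j m" for m
    proof -
      have "legal (\<lambda>i. ?D m i + s i)"
        by (rule legal_add_in_gap[OF f D(2,1)[OF \<open>m > 0\<close>] _ s_fin s(1) s_supp])
          (use that(2) in \<open>auto simp: used_def w_def\<close>)
      then have "legal_dec_of legal a (m + dec_value a s) (\<lambda>i. ?D m i + s i)"
        using D[OF \<open>m > 0\<close>] s_fin by (simp add: legal_dec_of_def fin_supp_add dec_value_add)
      \<comment> \<open>By uniqueness the legal sum is the decomposition of the shifted
        number.\<close>
      then have "?D (m + dec_value a s) = (\<lambda>i. ?D m i + s i)"
        using the_dec_eqI[OF uniq] \<open>m > 0\<close> by simp
      moreover have "i \<in> {j*w..<j*w+w}"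
        using i s_supp[of i] by (force simp: w_def)
      ultimately show ?thesis
        using i unfolding used_def by (intro bexI[of _ i]) simp_all
    qed
    then show "\<exists>v. \<forall>m>0. \<not> used j m \<longrightarrow> used j (m + v)"
      by (intro exI[of _ "dec_value a s"] allI impI)
  qed
  from choice[OF this] obtain v where "\<forall>j. \<forall>m>0. \<not> used j m \<longrightarrow> used j (m + v j)" ..
  then have v: "used j (m + v j)" if "m > 0" "\<not> used j m" for j m
    using that by simp

  \<comment> \<open>The factor 2 pays for each block being used only about half of the time; the
    extra 1 leaves one copy of \<open>a N - a 0\<close> to be bounded by \<open>V\<close>.\<close>
  obtain k :: nat where k: "2 * (B + d) + 1 \<le> real k"
    using real_arch_simple by blast
  define V where "V = (\<Sum>j<k. v j)"
  have bound: "a N - a 0 \<le> V" for N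
  proof -
    let ?T = "{a 0..<a N}"
    have "a N - a 0 \<le> 2 * card {m\<in>?T. used j m} + v j" for j
      by (rule card_interval_le_twice, rule v[OF order_less_le_trans[OF pos[of 0]]])
    then have "(\<Sum>j<k. a N - a 0) \<le> (\<Sum>j<k. 2 * card {m\<in>?T. used j m} + v j)"
      by (intro sum_mono)
    also have "\<dots> = 2 * (\<Sum>j<k. card {m\<in>?T. used j m}) + V"
      by (simp add: sum.distrib sum_distrib_left V_def)
    \<comment> \<open>Double counting of the pairs \<open>(j, m)\<close> with
      \<open>used j m\<close>.\<close>
    also have "(\<Sum>j<k. card {m\<in>?T. used j m}) = (\<Sum>m\<in>?T. card {j\<in>{..<k}. used j m})"
      using sum_multicount_gen[of "{..<k}" ?T used "\<lambda>m. card {j\<in>{..<k}. used j m}"] by simp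
    also have "\<dots> \<le> (\<Sum>m\<in>?T. num_summands (?D m))"
      using pos[of 0] unfolding used_def
      by (intro sum_mono card_used_blocks_le_num_summands[OF D(2) \<open>w > 0\<close>]) auto
    finally have "k * (a N - a 0) \<le> 2 * (\<Sum>m\<in>?T. num_summands (?D m)) + V"
      by simp
    from of_nat_mono[OF this, where 'a = real] have "real k * real (a N - a 0)
        \<le> 2 * (\<Sum>m\<in>?T. real (num_summands (?D m))) + real V"
      by simp
    also have "\<dots> \<le> 2 * ((B + d) * real (a N - a 0)) + real V"
      by (intro add_right_mono mult_left_mono le_K) simp
    finally have "real k * real (a N - a 0) \<le> 2 * ((B + d) * real (a N - a 0)) + real V" .
    moreover have "(2 * (B + d) + 1) * real (a N - a 0) \<le> real k * real (a N - a 0)"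
      using k by (intro mult_right_mono) auto
    ultimately show ?thesis
      by (simp add: algebra_simps)
  qed
  \<comment> \<open>\<open>V\<close> does not depend on \<open>N\<close>, whereas \<open>a\<close>
    is unbounded; at this index \<open>a N - a 0\<close> is at least \<open>V + 1\<close>.\<close>
  have "V + a 0 + 1 \<le> a (V + a 0 + 1)"
    using incr by (rule strict_mono_imp_increasing)
  with bound[of "V + a 0 + 1"] show False
    by linarith
qed

end
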